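(* Let $R$ be a commutative ring and let $\mathfrak{a}\subseteq R$ be an ideal. If $\Gamma_{\mathfrak{a}}$ is a radical, then the following statements are equivalent: (i) $\mathfrak{a}$ is centered; (ii) $\mathfrak{a}$ is well-centered; (iii) every $R$-module is weakly $\mathfrak{a}$-quasifair.
   Context: Rings are commutative with unit (not assumed noetherian). $\mathrm{Var}(\mathfrak{a})$ is the set of prime ideals of $R$ containing $\mathfrak{a}$, and for an $R$-module $M$, $\Gamma_{\mathfrak{a}}(M)=\{x\in M\mid\exists n\in\mathbb{N}:\mathfrak{a}^nx=0\}$; this defines a subfunctor $\Gamma_{\mathfrak{a}}$ of the identity functor on $R$-modules. The functor $\Gamma_{\mathfrak{a}}$ is called a radical if $\Gamma_{\mathfrak{a}}(M/\Gamma_{\mathfrak{a}}(M))=0$ for every $R$-module $M$. For $x\in M$, $(0:_Rx)=\{r\in R\mid rx=0\}$. The weak assassin $\mathrm{Ass}^{\rm f}_R(M)$ is the set of prime ideals $\mathfrak{p}$ of $R$ such that there exists $x\in M$ for which $\mathfrak{p}$ is minimal (with respect to inclusion) among the prime ideals containing $(0:_Rx)$. The ideal $\mathfrak{a}$ is called centered if for every $R$-module $M$ we have $\Gamma_{\mathfrak{a}}(M)=0\Leftrightarrow\mathrm{Ass}^{\rm f}_R(M)\cap\mathrm{Var}(\mathfrak{a})=\emptyset$; it is called half-centered if for every $R$-module $M$ we have $\Gamma_{\mathfrak{a}}(M)=M\Leftrightarrow\mathrm{Ass}^{\rm f}_R(M)\subseteq\mathrm{Var}(\mathfrak{a})$;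 it is called well-centered if it is centered and half-centered. An $R$-module $M$ is called weakly $\mathfrak{a}$-quasifair if $\mathrm{Ass}^{\rm f}_R(\Gamma_{\mathfrak{a}}(M))=\mathrm{Ass}^{\rm f}_R(M)\cap\mathrm{Var}(\mathfrak{a})$. *)

theory Defs
  imports "HOL-Algebra.Module" "HOL-Algebra.Ideal_Product"
begin

definition ideal_var :: "('a, 'r) ring_scheme \<Rightarrow> 'a set \<Rightarrow> 'a set set" where
  "ideal_var R I = {P. primeideal P R \<and> I \<subseteq> P}"

definition annihilator :: "('a, 'r) ring_scheme \<Rightarrow> ('a, 'm) module \<Rightarrow> 'm \<Rightarrow> 'a set" where
  "annihilator R M x = {r \<in> carrier R. r \<odot>\<^bsub>M\<^esub> x = \<zero>\<^bsub>M\<^esub>}"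

(* The power of the ideal I is taken in the multiplicative monoid of ideals of R,
   so its zeroth power is carrier R. *)
definition torsion :: "('a, 'r) ring_scheme \<Rightarrow> 'a set \<Rightarrow> ('a, 'm) module \<Rightarrow> 'm set" where
  "torsion R I M = {x \<in> carrier M. \<exists>n::nat. \<forall>r \<in> I [^]\<^bsub>ideals_set R\<^esub> n. r \<odot>\<^bsub>M\<^esub> x = \<zero>\<^bsub>M\<^esub>}"

abbreviation torsion_module ::
    "('a, 'r) ring_scheme \<Rightarrow> 'a set \<Rightarrow> ('a, 'm) module \<Rightarrow> ('a, 'm) module" where
  "torsion_module R I M \<equiv> M\<lparr>carrier := torsion R I M\<rparr>"

(* The fields mult and one of a module record carry no meaning; only carrier, zero, add
   and smult matter. *)
definition quotient_module :: "('a, 'm) module \<Rightarrow> 'm set \<Rightarrow> ('a, 'm set) module" where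
  "quotient_module M N =
    \<lparr>carrier = a_rcosets\<^bsub>M\<^esub> N, mult = undefined, one = undefined,
     zero = N, add = set_add M,
     smult = (\<lambda>r X. \<Union>x\<in>X. N +>\<^bsub>M\<^esub> (r \<odot>\<^bsub>M\<^esub> x))\<rparr>"

definition weak_assassin :: "('a, 'r) ring_scheme \<Rightarrow> ('a, 'm) module \<Rightarrow> 'a set set" where
  "weak_assassin R M =
    {P. \<exists>x \<in> carrier M. P \<in> ideal_var R (annihilator R M x) \<and>
          (\<forall>Q \<in> ideal_var R (annihilator R M x). Q \<subseteq> P \<longrightarrow> Q = P)}"

(* Quantification over all R-modules ranges over the modules whose carrier is a set of
   elements of the type 'm. This type is an explicit parameter, playing the role of a
   universe, since HOL has no quantification over types inside a formula. *)

definition torsion_radical :: "'m itself \<Rightarrow> ('a, 'r) ring_scheme \<Rightarrow> 'a set \<Rightarrow> bool" where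
  "torsion_radical (_ :: 'm itself) R I \<longleftrightarrow>
    (\<forall>M :: ('a, 'm) module. module R M \<longrightarrow>
      torsion R I (quotient_module M (torsion R I M))
        = {\<zero>\<^bsub>quotient_module M (torsion R I M)\<^esub>})"

definition centered :: "'m itself \<Rightarrow> ('a, 'r) ring_scheme \<Rightarrow> 'a set \<Rightarrow> bool" where
  "centered (_ :: 'm itself) R I \<longleftrightarrow>
    (\<forall>M :: ('a, 'm) module. module R M \<longrightarrow>
      (torsion R I M = {\<zero>\<^bsub>M\<^esub>} \<longleftrightarrow> weak_assassin R M \<inter> ideal_var R I = {}))"

definition half_centered :: "'m itself \<Rightarrow> ('a, 'r) ring_scheme \<Rightarrow> 'a set \<Rightarrow> bool" where
  "half_centered (_ :: 'm itself) R I \<longleftrightarrow>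
    (\<forall>M :: ('a, 'm) module. module R M \<longrightarrow>
      (torsion R I M = carrier M \<longleftrightarrow> weak_assassin R M \<subseteq> ideal_var R I))"

definition well_centered :: "'m itself \<Rightarrow> ('a, 'r) ring_scheme \<Rightarrow> 'a set \<Rightarrow> bool" where
  "well_centered U R I \<longleftrightarrow> centered U R I \<and> half_centered U R I"

definition weakly_quasifair :: "('a, 'r) ring_scheme \<Rightarrow> 'a set \<Rightarrow> ('a, 'm) module \<Rightarrow> bool" where
  "weakly_quasifair R I M \<longleftrightarrow>
    weak_assassin R (torsion_module R I M) = weak_assassin R M \<inter> ideal_var R I"

end

theory Submission
  imports "HOL-Algebra.Ring_Divisibility" Defs
begin

text \<open>
  Write \<open>T\<close> for the torsion submodule of \<open>M\<close> and \<open>Ass\<close> for the weak assassin. Everything rests on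
  testing centeredness on \<open>M/T\<close>, which has zero torsion because the torsion functor is a radical.
  If \<open>I\<close> is centered, it follows that \<open>Ass (M/T)\<close> contains no prime above \<open>I\<close>
  (\<open>weak_assassin_torsion_quotient\<close>), and two consequences are drawn from this.

  \<^item> \<open>M\<close> is weakly quasifair. The inclusion of \<open>Ass T\<close> in the primes of \<open>Ass M\<close> above \<open>I\<close> holds for
    every ideal, since the elements of \<open>T\<close> are killed by powers of \<open>I\<close>. Conversely \<open>Ass M\<close> lies in
    the union of \<open>Ass T\<close> and \<open>Ass (M/T)\<close> (\<open>weak_assassin_extension\<close>), and the second part does not
    contribute primes above \<open>I\<close>.

  \<^item> \<open>I\<close> is half-centered. Suppose that all of \<open>Ass M\<close> lies above \<open>I\<close> while some \<open>x\<close> is not in \<open>T\<close>.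
    The class of \<open>x\<close> in \<open>M/T\<close> gives some \<open>P\<close> in \<open>Ass (M/T)\<close>. As \<open>P\<close> contains the annihilator of \<open>x\<close>, it
    contains a minimal prime of that annihilator; this prime is in \<open>Ass M\<close>, hence contains \<open>I\<close>. So
    \<open>P\<close> contains \<open>I\<close>, a contradiction.

  Conversely, weak quasifairness of \<open>M\<close> turns the condition of centeredness into the equivalence
  of \<open>T = 0\<close> and \<open>Ass T = {}\<close>, which holds because every nonzero element has a minimal prime over
  its annihilator.

  The universe of modules consists of modules with carrier in one fixed type, whereas cosets live
  in a different type. So \<open>M/T\<close> is rebuilt on a system of coset representatives inside \<open>M\<close> before
  centeredness is applied to it.
\<close>

section \<open>Minimal primes\<close>

definition minimal_primes :: "('a, 'r) ring_scheme \<Rightarrow> 'a set \<Rightarrow> 'a set set" where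
  "minimal_primes R J =
    {P \<in> ideal_var R J. \<forall>Q \<in> ideal_var R J. Q \<subseteq> P \<longrightarrow> Q = P}"

lemma weak_assassin_iff:
  "P \<in> weak_assassin R M \<longleftrightarrow> (\<exists>x \<in> carrier M. P \<in> minimal_primes R (annihilator R M x))"
  by (auto simp: weak_assassin_def minimal_primes_def)

lemma minimal_primes_antimono:
  assumes "P \<in> minimal_primes R J" and "J \<subseteq> K" and "K \<subseteq> P"
  shows "P \<in> minimal_primes R K"
  using assms unfolding minimal_primes_def ideal_var_def by blast

lemma primeideal_Inter_chain:
  assumes "C \<noteq> {}" and prime: "\<And>P. P \<in> C \<Longrightarrow> primeideal P R"
    and chain: "\<And>P Q. P \<in> C \<Longrightarrow> Q \<in> C \<Longrightarrow> P \<subseteq> Q \<or> Q \<subseteq> P"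
  shows "primeideal (\<Inter>C) R"
proof -
  obtain P0 where P0: "P0 \<in> C" using \<open>C \<noteq> {}\<close> by blast
  interpret P0: primeideal P0 R using prime[OF P0] .
  show ?thesis
  proof (rule primeidealI)
    show "ideal (\<Inter>C) R"
      using P0.i_Intersect[of C] \<open>C \<noteq> {}\<close> primeideal.axioms(1)[OF prime] by blast
    show "cring R" by (rule P0.is_cring)
    show "carrier R \<noteq> \<Inter>C"
      using P0 P0.I_notcarr P0.a_subset by blast
    fix a b assume ab: "a \<in> carrier R" "b \<in> carrier R" "a \<otimes>\<^bsub>R\<^esub> b \<in> \<Inter>C"
    show "a \<in> \<Inter>C \<or> b \<in> \<Inter>C"
    proof (rule ccontr)
      assume "\<not> ?thesis"
      then obtain P Q where PQ: "P \<in> C" "a \<notin> P" "Q \<in> C" "b \<notin> Q" by blast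
      have "a \<notin> P \<inter> Q" "b \<notin> P \<inter> Q" using PQ by auto
      moreover have "P \<inter> Q \<in> C" using chain[OF PQ(1,3)] PQ by (metis inf.absorb1 inf.absorb2)
      ultimately show False
        using primeideal.I_prime[OF prime ab(1,2)] ab(3) by blast
    qed
  qed
qed

text \<open>Zorn's lemma is applied to the complements of the primes between \<open>J\<close> and \<open>P\<close>, so that
  a maximal complement gives a minimal prime; unions of chains of complements are complements of
  intersections of chains of primes, which are prime.\<close>

lemma minimal_prime_below:
  assumes "P \<in> ideal_var R J"
  shows "\<exists>Q \<in> minimal_primes R J. Q \<subseteq> P"
proof -
  define A where "A = (\<lambda>Q. - Q) ` {Q \<in> ideal_var R J. Q \<subseteq> P}"
  have "\<exists>M\<in>A. \<forall>X\<in>A. M \<subseteq> X \<longrightarrow> X = M"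
  proof (rule subset_Zorn_nonempty)
    show "A \<noteq> {}" using assms by (auto simp: A_def)
  next
    fix C assume C: "C \<noteq> {}" "subset.chain A C"
    define D where "D = uminus ` C"
    have sub: "Q \<in> ideal_var R J \<and> Q \<subseteq> P" if "Q \<in> D" for Q
      using that C(2) by (auto simp: D_def A_def pred_on.chain_def subset_iff)
    have "D \<noteq> {}" using C(1) by (simp add: D_def)
    have chain: "S \<subseteq> Q \<or> Q \<subseteq> S" if "S \<in> D" "Q \<in> D" for S Q
    proof -
      have "- S \<in> C" "- Q \<in> C" using that by (auto simp: D_def)
      then show ?thesis using C(2) unfolding pred_on.chain_def by blast
    qed
    have "primeideal (\<Inter>D) R"
      using primeideal_Inter_chain[OF \<open>D \<noteq> {}\<close> _ chain] sub by (auto simp: ideal_var_def)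
    then have "\<Inter>D \<in> {Q \<in> ideal_var R J. Q \<subseteq> P}"
      using sub \<open>D \<noteq> {}\<close> by (auto simp: ideal_var_def)
    moreover have "\<Union>C = - \<Inter>D" by (auto simp: D_def)
    ultimately show "\<Union>C \<in> A" by (auto simp: A_def)
  qed
  then obtain X where "X \<in> A" and max: "\<And>Y. Y \<in> A \<Longrightarrow> X \<subseteq> Y \<Longrightarrow> Y = X"
    by blast
  then obtain Q where Q: "Q \<in> ideal_var R J" "Q \<subseteq> P" and X: "X = - Q"
    by (auto simp: A_def)
  have "Q \<in> minimal_primes R J"
    unfolding minimal_primes_def
  proof (intro CollectI conjI ballI impI)
    fix S assume "S \<in> ideal_var R J" "S \<subseteq> Q"
    then show "S = Q" using max[of "- S"] Q(2) by (auto simp: A_def X)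
  qed (rule Q(1))
  with Q show ?thesis by blast
qed

text \<open>Krull's theorem: an ideal that is maximal among those avoiding \<open>\<one>\<close> is a maximal ideal, hence
  prime.\<close>

lemma (in cring) proper_ideal_in_primeideal:
  assumes "ideal J R" "\<one> \<notin> J"
  shows "\<exists>P. primeideal P R \<and> J \<subseteq> P"
proof -
  define A where "A = {K. ideal K R \<and> J \<subseteq> K \<and> \<one> \<notin> K}"
  have "\<exists>M\<in>A. \<forall>X\<in>A. M \<subseteq> X \<longrightarrow> X = M"
  proof (rule subset_Zorn_nonempty)
    show "A \<noteq> {}" using assms by (auto simp: A_def)
  next
    fix C assume C: "C \<noteq> {}" "subset.chain A C"
    then have "subset.chain {K. ideal K R} C"
      by (auto simp: A_def pred_on.chain_def)
    then have "ideal (\<Union>C) R"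
      using chain_Union_is_ideal[of C] C(1) by simp
    then show "\<Union>C \<in> A"
      using C by (auto simp: A_def pred_on.chain_def)
  qed
  then obtain P where "P \<in> A" and max: "\<And>X. X \<in> A \<Longrightarrow> P \<subseteq> X \<Longrightarrow> X = P"
    by blast
  then have P: "ideal P R" "J \<subseteq> P" "\<one> \<notin> P"
    by (auto simp: A_def)
  have "maximalideal P R"
  proof (rule maximalidealI)
    show "ideal P R" by fact
    show "carrier R \<noteq> P" using P(3) by auto
    fix K assume K: "ideal K R" "P \<subseteq> K" "K \<subseteq> carrier R"
    show "K = P \<or> K = carrier R"
      using max[of K] K P(2) ideal.one_imp_carrier[OF K(1)] by (auto simp: A_def)
  qed
  then show ?thesis using maximalideal_prime P(2) by blast
qed

section \<open>Annihilators and the weak assassin\<close>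

lemma annihilator_carrier_update [simp]:
  "annihilator R (M\<lparr>carrier := T\<rparr>) x = annihilator R M x"
  by (simp add: annihilator_def)

text \<open>The functions under study take modules without extra record fields, so the record type of
  \<open>M\<close> is narrowed here.\<close>

locale plain_module = module R M
  for R :: "('a, 'r) ring_scheme" (structure) and M :: "('a, 'c) module" (structure)
begin

lemma ideal_annihilator:
  assumes x: "x \<in> carrier M"
  shows "ideal (annihilator R M x) R"
proof (rule idealI)
  show "ring R" by (rule R.ring_axioms)
  show "subgroup (annihilator R M x) (add_monoid R)"
    using x by (intro R.add.subgroupI)
      (auto simp: annihilator_def smult_l_distr smult_l_minus)
next
  fix a r assume "a \<in> annihilator R M x" "r \<in> carrier R"
  then show "r \<otimes> a \<in> annihilator R M x" "a \<otimes> r \<in> annihilator R M x"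
    using x R.m_comm[of a r] by (auto simp: annihilator_def smult_assoc1)
qed

lemma minimal_prime_annihilator:
  assumes x: "x \<in> carrier M" and "x \<noteq> \<zero>\<^bsub>M\<^esub>"
  shows "\<exists>P. P \<in> minimal_primes R (annihilator R M x)"
proof -
  have "\<one> \<notin> annihilator R M x" using assms by (auto simp: annihilator_def)
  then obtain P where "P \<in> ideal_var R (annihilator R M x)"
    using R.proper_ideal_in_primeideal[OF ideal_annihilator[OF x]]
    by (auto simp: ideal_var_def)
  then show ?thesis using minimal_prime_below by blast
qed

lemma minimal_primes_annihilator_zero:
  "minimal_primes R (annihilator R M \<zero>\<^bsub>M\<^esub>) = {}"
proof -
  have "annihilator R M \<zero>\<^bsub>M\<^esub> = carrier R" by (auto simp: annihilator_def)
  moreover have "P = carrier R" if "primeideal P R" "carrier R \<subseteq> P" for P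
    using that additive_subgroup.a_subset ideal.axioms(1) primeideal.axioms(1) by blast
  ultimately show ?thesis
    using primeideal.I_notcarr by (fastforce simp: minimal_primes_def ideal_var_def)
qed

text \<open>A nonzero element has a proper annihilator, over which there is a minimal prime; the
  annihilator of zero is the whole ring and lies in no prime.\<close>

lemma weak_assassin_empty_iff:
  assumes "\<zero>\<^bsub>M\<^esub> \<in> T" "T \<subseteq> carrier M"
  shows "weak_assassin R (M\<lparr>carrier := T\<rparr>) = {} \<longleftrightarrow> T = {\<zero>\<^bsub>M\<^esub>}"
proof
  assume emp: "weak_assassin R (M\<lparr>carrier := T\<rparr>) = {}"
  have "x = \<zero>\<^bsub>M\<^esub>" if "x \<in> T" for x
    using minimal_prime_annihilator[of x] that emp assms
    by (force simp: weak_assassin_iff set_eq_iff)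
  then show "T = {\<zero>\<^bsub>M\<^esub>}" using assms by blast
next
  assume "T = {\<zero>\<^bsub>M\<^esub>}"
  then show "weak_assassin R (M\<lparr>carrier := T\<rparr>) = {}"
    using minimal_primes_annihilator_zero by (auto simp: weak_assassin_iff)
qed

text \<open>If \<open>s\<close> kills \<open>r x\<close>, then \<open>s r\<close> lies in the annihilator of \<open>x\<close>, hence in \<open>P\<close>, and \<open>r \<notin> P\<close> forces
  \<open>s \<in> P\<close>. So the annihilator of \<open>r x\<close> is squeezed between that of \<open>x\<close> and \<open>P\<close>.\<close>

lemma minimal_prime_smult:
  assumes x: "x \<in> carrier M" and P: "P \<in> minimal_primes R (annihilator R M x)"
    and r: "r \<in> carrier R" "r \<notin> P"
  shows "P \<in> minimal_primes R (annihilator R M (r \<odot>\<^bsub>M\<^esub> x))"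
proof (rule minimal_primes_antimono[OF P])
  have prime: "primeideal P R" and sub: "annihilator R M x \<subseteq> P"
    using P by (auto simp: minimal_primes_def ideal_var_def)
  show "annihilator R M x \<subseteq> annihilator R M (r \<odot>\<^bsub>M\<^esub> x)"
  proof
    fix s assume "s \<in> annihilator R M x"
    then have s: "s \<in> carrier R" "s \<odot>\<^bsub>M\<^esub> x = \<zero>\<^bsub>M\<^esub>" by (auto simp: annihilator_def)
    have "s \<odot>\<^bsub>M\<^esub> (r \<odot>\<^bsub>M\<^esub> x) = r \<odot>\<^bsub>M\<^esub> (s \<odot>\<^bsub>M\<^esub> x)"
      using x r(1) s(1) R.m_comm[of s r] smult_assoc1[of s r x] smult_assoc1[of r s x] by simp
    then show "s \<in> annihilator R M (r \<odot>\<^bsub>M\<^esub> x)" using s r(1) by (simp add: annihilator_def)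
  qed
  show "annihilator R M (r \<odot>\<^bsub>M\<^esub> x) \<subseteq> P"
  proof
    fix s assume s: "s \<in> annihilator R M (r \<odot>\<^bsub>M\<^esub> x)"
    then have "s \<in> carrier R" "s \<otimes> r \<in> annihilator R M x"
      using x r by (auto simp: annihilator_def smult_assoc1)
    then show "s \<in> P" using primeideal.I_prime[OF prime] sub r by blast
  qed
qed

section \<open>Quotient modules on coset representatives\<close>

definition coset_rep :: "'c set \<Rightarrow> 'c \<Rightarrow> 'c" where
  "coset_rep T x = (SOME y. y \<in> T +>\<^bsub>M\<^esub> x)"

text \<open>The quotient of \<open>M\<close> by \<open>T\<close>, transported to one chosen element of each coset. Unlike the module
  of cosets, it has its carrier in the same type as \<open>M\<close>, so that properties of all modules over
  that type apply to it.\<close>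

definition rep_quotient :: "'c set \<Rightarrow> ('a, 'c) module" where
  "rep_quotient T =
    \<lparr>carrier = coset_rep T ` carrier M, mult = undefined, one = undefined,
     zero = coset_rep T \<zero>\<^bsub>M\<^esub>, add = (\<lambda>x y. coset_rep T (x \<oplus>\<^bsub>M\<^esub> y)),
     smult = (\<lambda>r x. coset_rep T (r \<odot>\<^bsub>M\<^esub> x))\<rparr>"

lemma abelian_subgroup_submodule:
  "submodule T R M \<Longrightarrow> abelian_subgroup T M"
  using submodule.axioms(1) M.abelian_group_axioms
  by (blast intro: abelian_subgroupI3 additive_subgroupI)

lemma coset_eq_iff:
  assumes T: "submodule T R M" and "x \<in> carrier M" "y \<in> carrier M"
  shows "T +>\<^bsub>M\<^esub> x = T +>\<^bsub>M\<^esub> y \<longleftrightarrow> x \<ominus>\<^bsub>M\<^esub> y \<in> T"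
proof -
  interpret T: abelian_subgroup T M
    by (rule abelian_subgroup_submodule[OF T])
  show ?thesis
    using assms(2,3) T.a_rcos_module[of y x] T.a_repr_independence'[of x y] T.a_rcos_self[of x]
    by (auto simp: a_minus_def)
qed

lemma coset_rep:
  assumes T: "submodule T R M" and x: "x \<in> carrier M"
  shows "coset_rep T x \<in> carrier M" "T +>\<^bsub>M\<^esub> coset_rep T x = T +>\<^bsub>M\<^esub> x"
proof -
  interpret T: abelian_subgroup T M
    by (rule abelian_subgroup_submodule[OF T])
  have "coset_rep T x \<in> T +>\<^bsub>M\<^esub> x"
    unfolding coset_rep_def using T.a_rcos_self[OF x] by (rule someI)
  then show "coset_rep T x \<in> carrier M" "T +>\<^bsub>M\<^esub> coset_rep T x = T +>\<^bsub>M\<^esub> x"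
    using T.a_repr_independence' x M.a_r_coset_subset_G[OF T.a_subset x] by auto
qed

lemma coset_rep_eq_iff:
  assumes T: "submodule T R M" and "x \<in> carrier M" "y \<in> carrier M"
  shows "coset_rep T x = coset_rep T y \<longleftrightarrow> x \<ominus>\<^bsub>M\<^esub> y \<in> T"
  unfolding coset_eq_iff[OF assms, symmetric]
  using coset_rep(2)[OF T] assms(2,3) by (metis coset_rep_def)

lemma coset_rep_eq_zero_iff:
  assumes T: "submodule T R M" and x: "x \<in> carrier M"
  shows "coset_rep T x = coset_rep T \<zero>\<^bsub>M\<^esub> \<longleftrightarrow> x \<in> T"
proof -
  have "\<ominus>\<^bsub>M\<^esub> \<zero>\<^bsub>M\<^esub> = \<zero>\<^bsub>M\<^esub>"
    using M.r_neg[OF M.zero_closed] by simp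
  then have "x \<ominus>\<^bsub>M\<^esub> \<zero>\<^bsub>M\<^esub> = x"
    unfolding a_minus_def using x by (metis M.r_zero)
  then show ?thesis using x by (simp add: coset_rep_eq_iff[OF T])
qed

lemma coset_rep_diff:
  assumes T: "submodule T R M" and "x \<in> carrier M"
  shows "coset_rep T x \<ominus>\<^bsub>M\<^esub> x \<in> T"
  using coset_rep[OF assms] coset_eq_iff[OF T _ assms(2)] by blast

lemma coset_rep_add:
  assumes T: "submodule T R M" and x: "x \<in> carrier M" and y: "y \<in> carrier M"
  shows "coset_rep T (coset_rep T x \<oplus>\<^bsub>M\<^esub> coset_rep T y) = coset_rep T (x \<oplus>\<^bsub>M\<^esub> y)"
proof -
  let ?x = "coset_rep T x" and ?y = "coset_rep T y"
  note c = x y coset_rep(1)[OF T x] coset_rep(1)[OF T y]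
  have "(?x \<oplus>\<^bsub>M\<^esub> ?y) \<ominus>\<^bsub>M\<^esub> (x \<oplus>\<^bsub>M\<^esub> y) = (?x \<ominus>\<^bsub>M\<^esub> x) \<oplus>\<^bsub>M\<^esub> (?y \<ominus>\<^bsub>M\<^esub> y)"
    using c by (simp add: a_minus_def M.minus_add M.a_ac)
  also have "\<dots> \<in> T"
    using submoduleE(5)[OF T] coset_rep_diff[OF T] x y by blast
  finally show ?thesis using c by (simp add: coset_rep_eq_iff[OF T])
qed

lemma coset_rep_smult:
  assumes T: "submodule T R M" and r: "r \<in> carrier R" and x: "x \<in> carrier M"
  shows "coset_rep T (r \<odot>\<^bsub>M\<^esub> coset_rep T x) = coset_rep T (r \<odot>\<^bsub>M\<^esub> x)"
proof -
  let ?x = "coset_rep T x"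
  note c = r x coset_rep(1)[OF T x]
  have "(r \<odot>\<^bsub>M\<^esub> ?x) \<ominus>\<^bsub>M\<^esub> (r \<odot>\<^bsub>M\<^esub> x) = r \<odot>\<^bsub>M\<^esub> (?x \<ominus>\<^bsub>M\<^esub> x)"
    using c by (simp add: a_minus_def smult_r_distr smult_r_minus)
  also have "\<dots> \<in> T"
    using submoduleE(4)[OF T r] coset_rep_diff[OF T x] by blast
  finally show ?thesis using c by (simp add: coset_rep_eq_iff[OF T])
qed

lemma module_rep_quotient:
  assumes T: "submodule T R M"
  shows "module R (rep_quotient T)"
proof -
  (* Inner representatives can be dropped under an outer one, which leaves the axioms of M. *)
  have absorb:
    "coset_rep T (coset_rep T x \<oplus>\<^bsub>M\<^esub> y) = coset_rep T (x \<oplus>\<^bsub>M\<^esub> y)"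
    "coset_rep T (y \<oplus>\<^bsub>M\<^esub> coset_rep T x) = coset_rep T (y \<oplus>\<^bsub>M\<^esub> x)"
    if "x \<in> carrier M" "y \<in> carrier M" for x y
    using that coset_rep_add[OF T, of "coset_rep T x" y] coset_rep_add[OF T, of y "coset_rep T x"]
      coset_rep_add[OF T, of x y] coset_rep_add[OF T, of y x] coset_rep[OF T, of x]
    by (simp_all add: coset_rep_def)
  have idem: "coset_rep T (coset_rep T x) = coset_rep T x" if "x \<in> carrier M" for x
    using coset_rep(2)[OF T that] by (simp add: coset_rep_def)
  note simps = rep_quotient_def absorb idem coset_rep_smult[OF T] coset_rep(1)[OF T]
  have "abelian_group (rep_quotient T)"
  proof (rule abelian_groupI)
    fix x assume "x \<in> carrier (rep_quotient T)"
    then obtain y where "y \<in> carrier M" "x = coset_rep T y" by (auto simp: rep_quotient_def)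
    then show "\<exists>z\<in>carrier (rep_quotient T). z \<oplus>\<^bsub>rep_quotient T\<^esub> x = \<zero>\<^bsub>rep_quotient T\<^esub>"
      by (intro bexI[of _ "coset_rep T (\<ominus>\<^bsub>M\<^esub> y)"]) (auto simp: simps M.l_neg)
  qed (auto simp: simps M.a_assoc, simp add: M.a_comm)
  with R.is_cring show ?thesis
    by (rule moduleI) (auto simp: simps, simp_all add: smult_l_distr smult_r_distr smult_assoc1)
qed

lemma annihilator_rep_quotient:
  assumes T: "submodule T R M" and x: "x \<in> carrier M"
  shows "annihilator R (rep_quotient T) (coset_rep T x) = {r \<in> carrier R. r \<odot>\<^bsub>M\<^esub> x \<in> T}"
  using x coset_rep(1)[OF T x]
  by (auto simp: annihilator_def rep_quotient_def coset_rep_smult[OF T]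
      coset_rep_eq_zero_iff[OF T])

lemma annihilator_subset_rep_quotient:
  assumes T: "submodule T R M" and x: "x \<in> carrier M"
  shows "annihilator R M x \<subseteq> annihilator R (rep_quotient T) (coset_rep T x)"
  using subgroup.one_closed[OF submodule.axioms(1)[OF T]]
  unfolding annihilator_rep_quotient[OF T x] by (auto simp: annihilator_def)

text \<open>Let \<open>P\<close> be a minimal prime of the annihilator of \<open>x\<close>. If the annihilator of the class of \<open>x\<close> lies
  in \<open>P\<close>, then \<open>P\<close> is minimal over this larger ideal too. Otherwise some \<open>r \<notin> P\<close> moves \<open>x\<close> into \<open>T\<close>,
  and \<open>P\<close> is still a minimal prime of the annihilator of \<open>r x\<close>.\<close>

lemma weak_assassin_extension:
  assumes T: "submodule T R M"
  shows "weak_assassin R M \<subseteq>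
    weak_assassin R (M\<lparr>carrier := T\<rparr>) \<union> weak_assassin R (rep_quotient T)"
proof
  fix P assume "P \<in> weak_assassin R M"
  then obtain x where x: "x \<in> carrier M" and P: "P \<in> minimal_primes R (annihilator R M x)"
    by (auto simp: weak_assassin_iff)
  let ?A = "annihilator R (rep_quotient T) (coset_rep T x)"
  show "P \<in> weak_assassin R (M\<lparr>carrier := T\<rparr>) \<union> weak_assassin R (rep_quotient T)"
  proof (cases "?A \<subseteq> P")
    case True
    have "P \<in> minimal_primes R ?A"
      using minimal_primes_antimono[OF P annihilator_subset_rep_quotient[OF T x] True] .
    then show ?thesis using x by (auto simp: weak_assassin_iff rep_quotient_def)
  next
    case False
    then obtain r where r: "r \<in> carrier R" "r \<odot>\<^bsub>M\<^esub> x \<in> T" "r \<notin> P"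
      by (auto simp: annihilator_rep_quotient[OF T x])
    then have "P \<in> weak_assassin R (M\<lparr>carrier := T\<rparr>)"
      using minimal_prime_smult[OF x P r(1,3)] by (auto simp: weak_assassin_iff)
    then show ?thesis by blast
  qed
qed

end

section \<open>Ideal powers and torsion\<close>

context cring
begin

lemma ideal_power:
  assumes "ideal I R"
  shows "ideal (I [^]\<^bsub>ideals_set R\<^esub> (n::nat)) R"
  using monoid.nat_pow_closed[OF comm_monoid.axioms(1)[OF ideals_set_is_comm_monoid], of I n] assms
  by (simp add: ideals_set_def)

lemma ideal_power_Suc:
  "I [^]\<^bsub>ideals_set R\<^esub> Suc n = (I [^]\<^bsub>ideals_set R\<^esub> n) \<cdot> I"
  by (simp add: nat_pow_def ideals_set_def)

lemma ideal_power_antimono: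
  assumes I: "ideal I R" and "m \<le> (n::nat)"
  shows "I [^]\<^bsub>ideals_set R\<^esub> n \<subseteq> I [^]\<^bsub>ideals_set R\<^esub> m"
  using \<open>m \<le> n\<close>
proof (induction rule: dec_induct)
  case (step n)
  then show ?case
    using ideal_prod_inter[OF ideal_power[OF I, of n] I] unfolding ideal_power_Suc by blast
qed simp

lemma ideal_power_subset_primeideal:
  assumes I: "ideal I R" and P: "primeideal P R"
    and "I [^]\<^bsub>ideals_set R\<^esub> (n::nat) \<subseteq> P"
  shows "I \<subseteq> P"
  using assms(3)
proof (induction n)
  case 0
  then have "carrier R \<subseteq> P" by (simp add: nat_pow_def ideals_set_def)
  then show ?case using ideal.Icarr[OF I] by blast
next
  case (Suc n)
  then show ?case
    using primeideal_divides_ideal_prod[OF P ideal_power[OF I, of n] I]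
    unfolding ideal_power_Suc by blast
qed

end

context plain_module
begin

lemma submodule_torsion:
  assumes I: "ideal I R"
  shows "submodule (torsion R I M) R M"
proof (rule submoduleI)
  let ?p = "\<lambda>n::nat. I [^]\<^bsub>ideals_set R\<^esub> n"
  have carr: "r \<in> carrier R" if "r \<in> ?p n" for r n
    using ideal.Icarr[OF R.ideal_power[OF I]] that by blast
  show "torsion R I M \<subseteq> carrier M" by (auto simp: torsion_def)
  show "\<zero>\<^bsub>M\<^esub> \<in> torsion R I M" using carr by (auto simp: torsion_def)
  show "\<ominus>\<^bsub>M\<^esub> x \<in> torsion R I M" if "x \<in> torsion R I M" for x
    using that carr by (fastforce simp: torsion_def smult_r_minus)
  show "x \<oplus>\<^bsub>M\<^esub> y \<in> torsion R I M" if xy: "x \<in> torsion R I M" "y \<in> torsion R I M" for x y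
  proof -
    obtain m n where mn: "\<forall>r\<in>?p m. r \<odot>\<^bsub>M\<^esub> x = \<zero>\<^bsub>M\<^esub>" "\<forall>r\<in>?p n. r \<odot>\<^bsub>M\<^esub> y = \<zero>\<^bsub>M\<^esub>"
      using xy by (auto simp: torsion_def)
    have "?p (max m n) \<subseteq> ?p m" "?p (max m n) \<subseteq> ?p n"
      using R.ideal_power_antimono[OF I] by simp_all
    then have "\<forall>r\<in>?p (max m n). r \<odot>\<^bsub>M\<^esub> (x \<oplus>\<^bsub>M\<^esub> y) = \<zero>\<^bsub>M\<^esub>"
      using mn xy carr by (auto simp: torsion_def smult_r_distr subset_iff)
    then show ?thesis using xy by (auto simp: torsion_def)
  qed
  show "a \<odot>\<^bsub>M\<^esub> x \<in> torsion R I M" if a: "a \<in> carrier R" and x: "x \<in> torsion R I M" for a x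
  proof -
    obtain n where n: "\<forall>r\<in>?p n. r \<odot>\<^bsub>M\<^esub> x = \<zero>\<^bsub>M\<^esub>" and xM: "x \<in> carrier M"
      using x by (auto simp: torsion_def)
    have "r \<odot>\<^bsub>M\<^esub> (a \<odot>\<^bsub>M\<^esub> x) = \<zero>\<^bsub>M\<^esub>" if "r \<in> ?p n" for r
    proof -
      have "r \<odot>\<^bsub>M\<^esub> (a \<odot>\<^bsub>M\<^esub> x) = (r \<otimes> a) \<odot>\<^bsub>M\<^esub> x"
        using carr[OF that] a xM by (simp add: smult_assoc1)
      then show ?thesis using n ideal.I_r_closed[OF R.ideal_power[OF I] that a] by simp
    qed
    then show ?thesis using a xM by (auto simp: torsion_def)
  qed
qed

text \<open>An annihilator of a torsion element contains a power of \<open>I\<close>, and a prime containing a power of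
  \<open>I\<close> contains \<open>I\<close>.\<close>

lemma weak_assassin_torsion_subset:
  assumes I: "ideal I R"
  shows "weak_assassin R (torsion_module R I M) \<subseteq> weak_assassin R M \<inter> ideal_var R I"
proof
  fix P assume "P \<in> weak_assassin R (torsion_module R I M)"
  then obtain x where x: "x \<in> torsion R I M" and P: "P \<in> minimal_primes R (annihilator R M x)"
    by (auto simp: weak_assassin_iff)
  have prime: "primeideal P R" and sub: "annihilator R M x \<subseteq> P"
    using P by (auto simp: minimal_primes_def ideal_var_def)
  obtain n :: nat where "\<forall>r\<in>I [^]\<^bsub>ideals_set R\<^esub> n. r \<odot>\<^bsub>M\<^esub> x = \<zero>\<^bsub>M\<^esub>" and xM: "x \<in> carrier M"
    using x by (auto simp: torsion_def)
  then have "I [^]\<^bsub>ideals_set R\<^esub> n \<subseteq> annihilator R M x"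
    using ideal.Icarr[OF R.ideal_power[OF I]] by (auto simp: annihilator_def)
  then have "I \<subseteq> P"
    using R.ideal_power_subset_primeideal[OF I prime] sub by blast
  then show "P \<in> weak_assassin R M \<inter> ideal_var R I"
    using P xM prime by (auto simp: weak_assassin_iff ideal_var_def)
qed

lemma smult_quotient_module:
  assumes T: "submodule T R M" and r: "r \<in> carrier R" and x: "x \<in> carrier M"
  shows "r \<odot>\<^bsub>quotient_module M T\<^esub> (T +>\<^bsub>M\<^esub> x) = T +>\<^bsub>M\<^esub> (r \<odot>\<^bsub>M\<^esub> x)"
proof -
  interpret T: abelian_subgroup T M
    by (rule abelian_subgroup_submodule[OF T])
  have eq: "T +>\<^bsub>M\<^esub> (r \<odot>\<^bsub>M\<^esub> y) = T +>\<^bsub>M\<^esub> (r \<odot>\<^bsub>M\<^esub> x)" if "y \<in> T +>\<^bsub>M\<^esub> x" for y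
  proof -
    have y: "y \<in> carrier M" using M.a_r_coset_subset_G[OF T.a_subset x] that by blast
    have "y \<ominus>\<^bsub>M\<^esub> x \<in> T" using T.a_rcos_module[OF x y] that by (simp add: M.minus_eq)
    then have "r \<odot>\<^bsub>M\<^esub> (y \<ominus>\<^bsub>M\<^esub> x) \<in> T" using submoduleE(4)[OF T r] by blast
    then have "r \<odot>\<^bsub>M\<^esub> y \<ominus>\<^bsub>M\<^esub> r \<odot>\<^bsub>M\<^esub> x \<in> T"
      using r x y by (simp add: M.minus_eq smult_r_distr smult_r_minus)
    then show ?thesis using r x y by (simp add: coset_eq_iff[OF T])
  qed
  have "r \<odot>\<^bsub>quotient_module M T\<^esub> (T +>\<^bsub>M\<^esub> x)
      = (\<Union>y\<in>T +>\<^bsub>M\<^esub> x. T +>\<^bsub>M\<^esub> (r \<odot>\<^bsub>M\<^esub> y))"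
    by (simp add: quotient_module_def)
  also have "\<dots> = (\<Union>y\<in>T +>\<^bsub>M\<^esub> x. T +>\<^bsub>M\<^esub> (r \<odot>\<^bsub>M\<^esub> x))"
    by (rule SUP_cong[OF refl eq])
  also have "\<dots> = T +>\<^bsub>M\<^esub> (r \<odot>\<^bsub>M\<^esub> x)"
    using T.a_rcos_self[OF x] by blast
  finally show ?thesis .
qed

text \<open>The radical property speaks of the module of cosets, which is compared with the representatives
  elementwise: being killed by a power of \<open>I\<close> means in both cases that this power moves \<open>x\<close> into
  \<open>T\<close>.\<close>

lemma torsion_rep_quotient:
  assumes I: "ideal I R" and rad: "torsion_radical TYPE('c) R I"
  defines "T \<equiv> torsion R I M"
  shows "torsion R I (rep_quotient T) = {\<zero>\<^bsub>rep_quotient T\<^esub>}"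
proof -
  let ?p = "\<lambda>n::nat. I [^]\<^bsub>ideals_set R\<^esub> n"
  have T: "submodule T R M" unfolding T_def by (rule submodule_torsion[OF I])
  interpret T: abelian_subgroup T M
    by (rule abelian_subgroup_submodule[OF T])
  interpret Q: plain_module R "rep_quotient T"
    using module_rep_quotient[OF T] by (rule plain_module.intro)
  have carr: "r \<in> carrier R" if "r \<in> ?p n" for r n
    using ideal.Icarr[OF R.ideal_power[OF I]] that by blast
  have "coset_rep T x = \<zero>\<^bsub>rep_quotient T\<^esub>"
    if x: "x \<in> carrier M" and tor: "coset_rep T x \<in> torsion R I (rep_quotient T)" for x
  proof -
    obtain n where "\<forall>r\<in>?p n. r \<odot>\<^bsub>rep_quotient T\<^esub> coset_rep T x = \<zero>\<^bsub>rep_quotient T\<^esub>"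
      using tor by (auto simp: torsion_def)
    then have "?p n \<subseteq> annihilator R (rep_quotient T) (coset_rep T x)"
      using carr by (auto simp: annihilator_def)
    then have "\<forall>r\<in>?p n. r \<odot>\<^bsub>M\<^esub> x \<in> T"
      by (auto simp: annihilator_rep_quotient[OF T x])
    then have "\<forall>r\<in>?p n. r \<odot>\<^bsub>quotient_module M T\<^esub> (T +>\<^bsub>M\<^esub> x) = T"
      using carr x by (simp add: smult_quotient_module[OF T] T.a_rcos_const)
    then have "T +>\<^bsub>M\<^esub> x \<in> torsion R I (quotient_module M T)"
      using M.a_rcosetsI[OF T.a_subset x] by (auto simp: torsion_def quotient_module_def)
    moreover have "torsion R I (quotient_module M T) = {\<zero>\<^bsub>quotient_module M T\<^esub>}"
      using rad module_axioms unfolding torsion_radical_def T_def by blast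
    ultimately have "T +>\<^bsub>M\<^esub> x = T" by (simp add: quotient_module_def)
    then have "x \<in> T" using T.a_rcos_self[OF x] by simp
    then show ?thesis
      using x by (simp add: rep_quotient_def coset_rep_eq_zero_iff[OF T])
  qed
  moreover have "torsion R I (rep_quotient T) \<subseteq> coset_rep T ` carrier M"
    by (auto simp: torsion_def rep_quotient_def)
  moreover have "\<zero>\<^bsub>rep_quotient T\<^esub> \<in> torsion R I (rep_quotient T)"
    using subgroup.one_closed[OF submodule.axioms(1)[OF Q.submodule_torsion[OF I]]] by simp
  ultimately show ?thesis by blast
qed

section \<open>Centered ideals with radical torsion functor\<close>

lemma weak_assassin_torsion_quotient:
  assumes I: "ideal I R" and rad: "torsion_radical TYPE('c) R I"
    and cen: "centered TYPE('c) R I"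
  shows "weak_assassin R (rep_quotient (torsion R I M)) \<inter> ideal_var R I = {}"
  using cen module_rep_quotient[OF submodule_torsion[OF I]] torsion_rep_quotient[OF I rad]
  by (auto simp: centered_def)

lemma weakly_quasifair_if_centered:
  assumes I: "ideal I R" and rad: "torsion_radical TYPE('c) R I"
    and cen: "centered TYPE('c) R I"
  shows "weakly_quasifair R I M"
proof -
  let ?T = "torsion R I M"
  have T: "submodule ?T R M" by (rule submodule_torsion[OF I])
  have "weak_assassin R M \<inter> ideal_var R I \<subseteq> weak_assassin R (torsion_module R I M)"
    using weak_assassin_extension[OF T] weak_assassin_torsion_quotient[OF assms] by blast
  then show ?thesis
    using weak_assassin_torsion_subset[OF I] by (auto simp: weakly_quasifair_def)
qed

text \<open>A prime \<open>P\<close> attached to the nonzero class of \<open>x\<close> in the quotient need not belong to the weak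
  assassin of \<open>M\<close>, but it contains a minimal prime of the annihilator of \<open>x\<close>, and containing \<open>I\<close>
  passes up from that prime to \<open>P\<close>.\<close>

lemma torsion_eq_carrier_if_centered:
  assumes I: "ideal I R" and rad: "torsion_radical TYPE('c) R I"
    and cen: "centered TYPE('c) R I"
    and sub: "weak_assassin R M \<subseteq> ideal_var R I"
  shows "torsion R I M = carrier M"
proof -
  let ?T = "torsion R I M"
  have T: "submodule ?T R M" by (rule submodule_torsion[OF I])
  interpret Q: plain_module R "rep_quotient ?T"
    using module_rep_quotient[OF T] by (rule plain_module.intro)
  have "x \<in> ?T" if x: "x \<in> carrier M" for x
  proof (rule ccontr)
    assume "x \<notin> ?T"
    let ?A = "annihilator R (rep_quotient ?T) (coset_rep ?T x)"
    have xQ: "coset_rep ?T x \<in> carrier (rep_quotient ?T)"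
      using x by (simp add: rep_quotient_def)
    have "coset_rep ?T x \<noteq> \<zero>\<^bsub>rep_quotient ?T\<^esub>"
      using x \<open>x \<notin> ?T\<close> by (simp add: rep_quotient_def coset_rep_eq_zero_iff[OF T])
    then obtain P where P: "P \<in> minimal_primes R ?A"
      using Q.minimal_prime_annihilator[OF xQ] by blast
    have "P \<in> ideal_var R (annihilator R M x)"
      using P annihilator_subset_rep_quotient[OF T x] by (auto simp: minimal_primes_def ideal_var_def)
    then obtain Q where Q: "Q \<in> minimal_primes R (annihilator R M x)" "Q \<subseteq> P"
      using minimal_prime_below by blast
    then have "Q \<in> weak_assassin R M" using x by (auto simp: weak_assassin_iff)
    then have "Q \<in> ideal_var R I" using sub by blast
    then have "P \<in> ideal_var R I"
      using P Q(2) by (auto simp: minimal_primes_def ideal_var_def)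
    moreover have "P \<in> weak_assassin R (rep_quotient ?T)"
      using P xQ by (auto simp: weak_assassin_iff)
    ultimately show False using weak_assassin_torsion_quotient[OF I rad cen] by blast
  qed
  then show ?thesis using submoduleE(1)[OF T] by blast
qed

lemma torsion_zero_iff_if_weakly_quasifair:
  assumes I: "ideal I R" and fair: "weakly_quasifair R I M"
  shows "torsion R I M = {\<zero>\<^bsub>M\<^esub>} \<longleftrightarrow> weak_assassin R M \<inter> ideal_var R I = {}"
proof -
  have "\<zero>\<^bsub>M\<^esub> \<in> torsion R I M"
    using subgroup.one_closed[OF submodule.axioms(1)[OF submodule_torsion[OF I]]] by simp
  then show ?thesis
    using weak_assassin_empty_iff[of "torsion R I M"] submoduleE(1)[OF submodule_torsion[OF I]] fair
    by (auto simp: weakly_quasifair_def)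
qed

end

theorem mainTheorem6:
  fixes R :: "('a, 'r) ring_scheme" and I :: "'a set"
  assumes "cring R" and "ideal I R"
    and "torsion_radical TYPE('m) R I"
  shows "(centered TYPE('m) R I \<longleftrightarrow> well_centered TYPE('m) R I)
       \<and> (well_centered TYPE('m) R I \<longleftrightarrow>
            (\<forall>M :: ('a, 'm) module. module R M \<longrightarrow> weakly_quasifair R I M))"
proof -
  have half: "half_centered TYPE('m) R I" if cen: "centered TYPE('m) R I"
    unfolding half_centered_def
  proof (intro allI impI iffI)
    fix M :: "('a, 'm) module" assume "module R M"
    then interpret plain_module R M by (rule plain_module.intro)
    show "weak_assassin R M \<subseteq> ideal_var R I" if "torsion R I M = carrier M"
      using weak_assassin_torsion_subset[OF assms(2)] that by simp
    show "torsion R I M = carrier M" if "weak_assassin R M \<subseteq> ideal_var R I"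
      by (rule torsion_eq_carrier_if_centered[OF assms(2,3) cen that])
  qed
  have fair: "weakly_quasifair R I M" if "centered TYPE('m) R I" "module R M"
    for M :: "('a, 'm) module"
    using plain_module.weakly_quasifair_if_centered[OF plain_module.intro assms(2,3)] that by blast
  have cen: "centered TYPE('m) R I"
    if "\<forall>M :: ('a, 'm) module. module R M \<longrightarrow> weakly_quasifair R I M"
    unfolding centered_def
    using plain_module.torsion_zero_iff_if_weakly_quasifair[OF plain_module.intro assms(2)] that
    by blast
  from half fair cen show ?thesis by (auto simp: well_centered_def)
qed

end
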